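(* Let $\epsilon=(\epsilon^{(1)},\ldots,\epsilon^{(n)})^T$ be a random vector in $\mathbb{R}^n$ with finite mean whose distribution is absolutely continuous with respect to the Lebesgue measure and fully supported on $\mathbb{R}^n$. Let $E$ be its surplus function and assume that the convex conjugate $E^*$ is strongly convex on the simplex $\Delta$ with respect to $\|\cdot\|_1$. Then for every $u\in\mathbb{R}^n$ the unique maximizer $p\in\Delta$ of the optimization problem $$E(u)=\sup_{p\in\Delta}\ \langle p,u\rangle-E^*(p)$$ is given by the choice probabilities $$p^{(i)}=\mathbb{P}\left(u^{(i)}+\epsilon^{(i)}=\max_{1\le j\le n}\left(u^{(j)}+\epsilon^{(j)}\right)\right),\qquad i=1,\ldots,n.$$
   Context: The surplus function is $E(u)=\mathbb{E}_\epsilon\left(\max_{1\le i\le n}\left(u^{(i)}+\epsilon^{(i)}\right)\right)$, $u\in\mathbb{R}^n$. Its convex conjugate is $E^*(p)=\sup_{u\in\mathbb{R}^n}\left(\langle p,u\rangle-E(u)\right)$; it is finite exactly on the simplex $\Delta=\{p\in\mathbb{R}^n\mid \sum_{i=1}^n p^{(i)}=1,\ p^{(i)}\ge 0\}$. With $\|x\|_1=\sum_i|x^{(i)}|$, $E^*$ is strongly convex on $\Delta$ with respect to $\|\cdot\|_1$ if there is $\beta>0$ such that for all $p,q\in\Delta$ and $\alpha\in[0,1]$: $E^*(\alpha p+(1-\alpha)q)\le\alpha E^*(p)+(1-\alpha)E^*(q)-\frac{\beta}{2}\alpha(1-\alpha)\|p-q\|_1^2$. *)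

theory Defs
  imports "HOL-Probability.Probability"
begin

definition prob_simplex :: "(real ^ 'n) set" where
  "prob_simplex = {p. (\<Sum>i\<in>UNIV. p $ i) = 1 \<and> (\<forall>i. 0 \<le> p $ i)}"

definition norm_l1 :: "real ^ 'n \<Rightarrow> real" where
  "norm_l1 x = (\<Sum>i\<in>UNIV. \<bar>x $ i\<bar>)"

definition surplus :: "'a measure \<Rightarrow> ('a \<Rightarrow> real ^ 'n) \<Rightarrow> real ^ 'n \<Rightarrow> real" where
  "surplus M \<epsilon> u = (\<integral>\<omega>. (MAX i. u $ i + \<epsilon> \<omega> $ i) \<partial>M)"

definition convex_conjugate :: "('v::real_inner \<Rightarrow> real) \<Rightarrow> 'v \<Rightarrow> ereal" where
  "convex_conjugate f p = (SUP u. ereal (p \<bullet> u - f u))"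

text \<open>
  Strong convexity on \<open>S\<close> with respect to a norm \<open>N\<close>, for extended real-valued functions. The
  subtracted term is real, and a convex conjugate never takes the value \<open>-\<infinity>\<close>, so for conjugates
  no indeterminate expression \<open>\<infinity> - \<infinity>\<close> arises.
\<close>
definition strongly_convex_on ::
    "('v::real_vector \<Rightarrow> real) \<Rightarrow> 'v set \<Rightarrow> ('v \<Rightarrow> ereal) \<Rightarrow> bool" where
  "strongly_convex_on N S f \<longleftrightarrow>
     (\<exists>\<beta>>0. \<forall>p\<in>S. \<forall>q\<in>S. \<forall>\<alpha>\<in>{0..1}.
        f (\<alpha> *\<^sub>R p + (1 - \<alpha>) *\<^sub>R q)
          \<le> ereal \<alpha> * f p + ereal (1 - \<alpha>) * f q
             - ereal (\<beta> / 2 * \<alpha> * (1 - \<alpha>) * (N (p - q))\<^sup>2))"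

definition topological_support :: "('v::topological_space) measure \<Rightarrow> 'v set" where
  "topological_support \<mu> = {x. \<forall>U. open U \<longrightarrow> x \<in> U \<longrightarrow> 0 < emeasure \<mu> U}"

definition choice_probabilities ::
    "'a measure \<Rightarrow> ('a \<Rightarrow> real ^ 'n) \<Rightarrow> real ^ 'n \<Rightarrow> real ^ 'n" where
  "choice_probabilities M \<epsilon> u =
     (\<chi> i. measure M {\<omega> \<in> space M. u $ i + \<epsilon> \<omega> $ i = (MAX j. u $ j + \<epsilon> \<omega> $ j)})"

end

theory Submission
  imports Defs
begin

text \<open>
  Write \<open>E\<close> for the surplus and \<open>g u\<close> for the vector of choice probabilities at \<open>u\<close>. Hyperplanes
  are Lebesgue null, so by absolute continuity ties between the utilities \<open>u\<^sub>i + \<epsilon>\<^sub>i\<close> have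
  probability zero and almost surely exactly one alternative attains the maximum. Two things follow.
  The choice probabilities sum to 1, so \<open>g u\<close> lies in the simplex. Moreover, if \<open>i\<close> is the
  alternative chosen under \<open>u\<close>, then the maximal utility under \<open>v\<close> is at least
  \<open>v\<^sub>i + \<epsilon>\<^sub>i\<close>, that is, the maximal utility under \<open>u\<close> plus \<open>v\<^sub>i - u\<^sub>i\<close>; taking expectations, \<open>g u\<close> is a
  subgradient of \<open>E\<close> at \<open>u\<close>.

  A subgradient at \<open>u\<close> gives equality in the Fenchel--Young inequality
  \<open>\<langle>p, u\<rangle> - E\<^sup>* p \<le> E u\<close>. Hence \<open>g u\<close> is a maximizer and the maximal value is
  \<open>E u\<close>. Any two maximizers in the simplex agree by strong convexity of \<open>E\<^sup>*\<close>, since otherwise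
  their midpoint would have a value above \<open>E u\<close>.
\<close>

section \<open>Convex conjugates and strong convexity\<close>

lemma Fenchel_Young: "ereal (p \<bullet> u - f u) \<le> convex_conjugate f p"
  unfolding convex_conjugate_def by (rule SUP_upper) simp

lemma conjugate_objective_le: "ereal (p \<bullet> u) - convex_conjugate f p \<le> ereal (f u)"
  using Fenchel_Young[of p u f] by (cases "convex_conjugate f p") auto

lemma convex_conjugate_at_subgradient:
  assumes "\<And>v. f u + g \<bullet> (v - u) \<le> f v"
  shows "convex_conjugate f g = ereal (g \<bullet> u - f u)"
proof (rule antisym)
  show "convex_conjugate f g \<le> ereal (g \<bullet> u - f u)"
    unfolding convex_conjugate_def
  proof (rule SUP_least)
    fix v
    show "ereal (g \<bullet> v - f v) \<le> ereal (g \<bullet> u - f u)"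
      using assms[of v] by (simp add: inner_diff_right)
  qed
qed (rule Fenchel_Young)

text \<open>
  The conditions on \<open>p\<close> and \<open>q\<close> say that both attain equality in the Fenchel--Young inequality at
  \<open>u\<close>. Applying that inequality at their midpoint leaves no room for the strong convexity gap.
\<close>

lemma maximizers_unique_if_strongly_convex:
  assumes sc: "strongly_convex_on N S (convex_conjugate f)"
    and p: "p \<in> S" "convex_conjugate f p = ereal (p \<bullet> u - f u)"
    and q: "q \<in> S" "convex_conjugate f q = ereal (q \<bullet> u - f u)"
  shows "N (p - q) = 0"
proof -
  obtain \<beta> where "\<beta> > 0" and
    sc': "\<And>\<alpha>. \<alpha> \<in> {0..1} \<Longrightarrow> convex_conjugate f (\<alpha> *\<^sub>R p + (1 - \<alpha>) *\<^sub>R q)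
          \<le> ereal \<alpha> * convex_conjugate f p + ereal (1 - \<alpha>) * convex_conjugate f q
             - ereal (\<beta> / 2 * \<alpha> * (1 - \<alpha>) * (N (p - q))\<^sup>2)"
    using sc p(1) q(1) unfolding strongly_convex_on_def by blast
  define m where "m = (1/2) *\<^sub>R p + (1 - 1/2) *\<^sub>R q"
  have "ereal (m \<bullet> u - f u) \<le> convex_conjugate f m"
    by (rule Fenchel_Young)
  also have "\<dots> \<le> ereal (1/2) * convex_conjugate f p + ereal (1 - 1/2) * convex_conjugate f q
                    - ereal (\<beta> / 2 * (1/2) * (1 - 1/2) * (N (p - q))\<^sup>2)"
    unfolding m_def by (rule sc') simp
  also have "\<dots> = ereal ((p \<bullet> u - f u) / 2 + (q \<bullet> u - f u) / 2 - \<beta> / 8 * (N (p - q))\<^sup>2)"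
    unfolding p(2) q(2) by simp
  finally have "m \<bullet> u - f u
      \<le> (p \<bullet> u - f u) / 2 + (q \<bullet> u - f u) / 2 - \<beta> / 8 * (N (p - q))\<^sup>2"
    by simp
  moreover have "m \<bullet> u = (p \<bullet> u) / 2 + (q \<bullet> u) / 2"
    by (simp add: m_def inner_add_left)
  ultimately have "\<beta> / 8 * (N (p - q))\<^sup>2 \<le> 0"
    by (simp add: field_simps)
  with \<open>\<beta> > 0\<close> show ?thesis
    by (simp add: mult_le_0_iff)
qed

lemma norm_l1_eq_0_iff: "norm_l1 x = 0 \<longleftrightarrow> x = 0"
  unfolding norm_l1_def by (simp add: sum_nonneg_eq_0_iff vec_eq_iff)

section \<open>Choice probabilities as subgradients of the surplus\<close>

lemma integrable_max_utility:
  fixes M :: "'a measure" and \<epsilon> :: "'a \<Rightarrow> real ^ 'n"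
  assumes "prob_space M" and int: "integrable M \<epsilon>"
  shows "integrable M (\<lambda>\<omega>. MAX i. u $ i + \<epsilon> \<omega> $ i)"
proof -
  interpret prob_space M by fact
  have meas: "\<epsilon> \<in> borel_measurable M"
    using int by simp
  have [measurable]: "(\<lambda>\<omega>. \<epsilon> \<omega> $ i) \<in> borel_measurable M" for i
    using measurable_compose[OF meas borel_measurable_nth] .
  show ?thesis
  proof (rule Bochner_Integration.integrable_bound)
    show "integrable M (\<lambda>\<omega>. u + \<epsilon> \<omega>)"
      using int by simp
    show "(\<lambda>\<omega>. MAX i. u $ i + \<epsilon> \<omega> $ i) \<in> borel_measurable M"
      by (rule borel_measurable_Max) auto
    have "norm (MAX i. u $ i + \<epsilon> \<omega> $ i) \<le> norm (u + \<epsilon> \<omega>)" for \<omega>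
    proof -
      have "(MAX i. u $ i + \<epsilon> \<omega> $ i) \<in> range (\<lambda>i. u $ i + \<epsilon> \<omega> $ i)"
        by (rule Max_in) auto
      then obtain i where "(MAX i. u $ i + \<epsilon> \<omega> $ i) = u $ i + \<epsilon> \<omega> $ i"
        by (rule rangeE)
      then show ?thesis
        using component_le_norm_cart[of "u + \<epsilon> \<omega>" i] by simp
    qed
    then show "AE \<omega> in M. norm (MAX i. u $ i + \<epsilon> \<omega> $ i) \<le> norm (u + \<epsilon> \<omega>)"
      by simp
  qed
qed

lemma AE_no_ties:
  fixes M :: "'a measure" and \<epsilon> :: "'a \<Rightarrow> real ^ 'n"
  assumes meas: "\<epsilon> \<in> borel_measurable M"
    and ac: "absolutely_continuous lborel (distr M borel \<epsilon>)"
    and "i \<noteq> j"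
  shows "AE \<omega> in M. u $ i + \<epsilon> \<omega> $ i \<noteq> u $ j + \<epsilon> \<omega> $ j"
proof -
  define a :: "real ^ 'n" where "a = axis i 1 - axis j 1"
  define H where "H = {x. a \<bullet> x = u $ j - u $ i}"
  have a: "a \<bullet> x = x $ i - x $ j" for x
    by (simp add: a_def inner_diff_left inner_axis')
  have "a $ i \<noteq> 0"
    using \<open>i \<noteq> j\<close> by (simp add: a_def axis_def)
  then have "a \<noteq> 0" by auto
  then have "negligible H"
    unfolding H_def by (intro negligible_hyperplane) simp
  moreover have "H \<in> sets borel"
    unfolding H_def by (intro borel_closed closed_hyperplane)
  ultimately have "H \<in> null_sets lborel"
    by (simp add: negligible_iff_null_sets null_sets_completion_iff)
  then have "H \<in> null_sets (distr M borel \<epsilon>)"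
    using ac unfolding absolutely_continuous_def by blast
  then have "\<epsilon> -` H \<inter> space M \<in> null_sets M"
    using meas by (simp add: null_sets_distr_iff)
  then show ?thesis
    by (rule AE_I') (auto simp: H_def a)
qed

lemma AE_unique_choice:
  fixes M :: "'a measure" and \<epsilon> :: "'a \<Rightarrow> real ^ 'n"
  assumes meas: "\<epsilon> \<in> borel_measurable M"
    and ac: "absolutely_continuous lborel (distr M borel \<epsilon>)"
  shows "AE \<omega> in M. \<exists>i. \<forall>j. u $ j + \<epsilon> \<omega> $ j = (MAX k. u $ k + \<epsilon> \<omega> $ k) \<longleftrightarrow> j = i"
proof -
  have "AE \<omega> in M. \<forall>i\<in>UNIV. \<forall>j\<in>UNIV. i \<noteq> j \<longrightarrow> u $ i + \<epsilon> \<omega> $ i \<noteq> u $ j + \<epsilon> \<omega> $ j"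
    using AE_no_ties[OF meas ac] by (intro AE_finite_allI) auto
  then show ?thesis
  proof eventually_elim
    case (elim \<omega>)
    have "(MAX i. u $ i + \<epsilon> \<omega> $ i) \<in> range (\<lambda>i. u $ i + \<epsilon> \<omega> $ i)"
      by (rule Max_in) auto
    then obtain i where "(MAX i. u $ i + \<epsilon> \<omega> $ i) = u $ i + \<epsilon> \<omega> $ i"
      by (rule rangeE)
    with elim show ?case
      by (intro exI[of _ i]) auto
  qed
qed

text \<open>
  An inner product with the choice probabilities is the expected total weight of the alternatives
  that attain the maximum. With no ties and all weights equal to 1 this gives membership in the simplex, with weights \<open>v - u\<close> the
  subgradient inequality.
\<close>

lemma inner_choice_probabilities:
  fixes M :: "'a measure" and \<epsilon> :: "'a \<Rightarrow> real ^ 'n"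
  assumes "prob_space M" and meas: "\<epsilon> \<in> borel_measurable M"
  defines "A \<equiv> \<lambda>u i. {\<omega> \<in> space M. u $ i + \<epsilon> \<omega> $ i = (MAX j. u $ j + \<epsilon> \<omega> $ j)}"
  shows "integrable M (\<lambda>\<omega>. \<Sum>i\<in>UNIV. w $ i * indicator (A u i) \<omega>)"
    and "choice_probabilities M \<epsilon> u \<bullet> w = (\<integral>\<omega>. (\<Sum>i\<in>UNIV. w $ i * indicator (A u i) \<omega>) \<partial>M)"
proof -
  interpret prob_space M by fact
  have [measurable]: "(\<lambda>\<omega>. \<epsilon> \<omega> $ i) \<in> borel_measurable M" for i
    using measurable_compose[OF meas borel_measurable_nth] .
  have [measurable]: "(\<lambda>\<omega>. MAX i. u $ i + \<epsilon> \<omega> $ i) \<in> borel_measurable M"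
    by (rule borel_measurable_Max) auto
  have A [measurable]: "A u i \<in> sets M" for i
    unfolding A_def by measurable
  have int: "integrable M (\<lambda>\<omega>. w $ i * indicator (A u i) \<omega>)" for i
    by (intro integrable_mult_right integrable_real_indicator) (auto simp: emeasure_eq_measure)
  then show "integrable M (\<lambda>\<omega>. \<Sum>i\<in>UNIV. w $ i * indicator (A u i) \<omega>)"
    by (intro Bochner_Integration.integrable_sum)
  have "(\<integral>\<omega>. (\<Sum>i\<in>UNIV. w $ i * indicator (A u i) \<omega>) \<partial>M)
      = (\<Sum>i\<in>UNIV. \<integral>\<omega>. w $ i * indicator (A u i) \<omega> \<partial>M)"
    by (rule Bochner_Integration.integral_sum) (rule int)
  also have "\<dots> = (\<Sum>i\<in>UNIV. w $ i * measure M (A u i))"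
    by (simp only: integral_mult_right_zero Bochner_Integration.integral_indicator
        Int_absorb2[OF sets.sets_into_space[OF A]])
  finally show "choice_probabilities M \<epsilon> u \<bullet> w
      = (\<integral>\<omega>. (\<Sum>i\<in>UNIV. w $ i * indicator (A u i) \<omega>) \<partial>M)"
    by (simp add: choice_probabilities_def A_def inner_vec_def mult.commute)
qed

lemma choice_probabilities_in_simplex:
  fixes M :: "'a measure" and \<epsilon> :: "'a \<Rightarrow> real ^ 'n"
  assumes prob: "prob_space M" and meas: "\<epsilon> \<in> borel_measurable M"
    and ac: "absolutely_continuous lborel (distr M borel \<epsilon>)"
  shows "choice_probabilities M \<epsilon> u \<in> prob_simplex"
proof -
  interpret prob_space M by fact
  let ?A = "\<lambda>i. {\<omega> \<in> space M. u $ i + \<epsilon> \<omega> $ i = (MAX j. u $ j + \<epsilon> \<omega> $ j)}"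
  have "(\<Sum>i\<in>UNIV. choice_probabilities M \<epsilon> u $ i)
      = (\<integral>\<omega>. (\<Sum>i\<in>UNIV. indicator (?A i) \<omega>) \<partial>M)"
    using inner_choice_probabilities(2)[OF prob meas, of u "\<chi> i. 1"]
    by (simp add: inner_vec_def)
  also have "\<dots> = (\<integral>\<omega>. 1 \<partial>M)"
  proof (rule integral_cong_AE)
    show "(\<lambda>\<omega>. \<Sum>i\<in>UNIV. indicator (?A i) \<omega> :: real) \<in> borel_measurable M"
      using inner_choice_probabilities(1)[OF prob meas, of "\<chi> i. 1" u]
      by (simp add: borel_measurable_integrable)
    show "AE \<omega> in M. (\<Sum>i\<in>UNIV. indicator (?A i) \<omega>) = (1::real)"
      using AE_unique_choice[OF meas ac, of u] AE_space
      by eventually_elim (auto simp: indicator_def)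
  qed simp
  also have "\<dots> = 1"
    by (simp add: prob_space)
  finally show ?thesis
    by (simp add: prob_simplex_def choice_probabilities_def)
qed

lemma choice_probabilities_subgradient:
  fixes M :: "'a measure" and \<epsilon> :: "'a \<Rightarrow> real ^ 'n"
  assumes prob: "prob_space M" and int: "integrable M \<epsilon>"
    and ac: "absolutely_continuous lborel (distr M borel \<epsilon>)"
  shows "surplus M \<epsilon> u + choice_probabilities M \<epsilon> u \<bullet> (v - u) \<le> surplus M \<epsilon> v"
proof -
  have meas: "\<epsilon> \<in> borel_measurable M"
    using int by simp
  let ?A = "\<lambda>i. {\<omega> \<in> space M. u $ i + \<epsilon> \<omega> $ i = (MAX j. u $ j + \<epsilon> \<omega> $ j)}"
  have "choice_probabilities M \<epsilon> u \<bullet> (v - u)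
      = (\<integral>\<omega>. (\<Sum>i\<in>UNIV. (v - u) $ i * indicator (?A i) \<omega>) \<partial>M)"
    by (rule inner_choice_probabilities(2)[OF prob meas])
  also have "\<dots> \<le> (\<integral>\<omega>. (MAX i. v $ i + \<epsilon> \<omega> $ i) - (MAX i. u $ i + \<epsilon> \<omega> $ i) \<partial>M)"
  proof (rule integral_mono_AE)
    show "integrable M (\<lambda>\<omega>. \<Sum>i\<in>UNIV. (v - u) $ i * indicator (?A i) \<omega>)"
      by (rule inner_choice_probabilities(1)[OF prob meas])
    show "integrable M (\<lambda>\<omega>. (MAX i. v $ i + \<epsilon> \<omega> $ i) - (MAX i. u $ i + \<epsilon> \<omega> $ i))"
      by (intro Bochner_Integration.integrable_diff integrable_max_utility prob int)
    show "AE \<omega> in M. (\<Sum>i\<in>UNIV. (v - u) $ i * indicator (?A i) \<omega>)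
        \<le> (MAX i. v $ i + \<epsilon> \<omega> $ i) - (MAX i. u $ i + \<epsilon> \<omega> $ i)"
      using AE_unique_choice[OF meas ac, of u] AE_space
    proof eventually_elim
      case (elim \<omega>)
      then obtain i where i: "\<And>j. u $ j + \<epsilon> \<omega> $ j = (MAX k. u $ k + \<epsilon> \<omega> $ k) \<longleftrightarrow> j = i"
        by blast
      have "indicator (?A j) \<omega> = (if j = i then 1 else 0 :: real)" for j
        using i elim(2) by (simp add: indicator_def)
      then have "(\<Sum>j\<in>UNIV. (v - u) $ j * indicator (?A j) \<omega>)
          = (\<Sum>j\<in>UNIV. if j = i then (v - u) $ j else 0)"
        by (intro sum.cong refl) (simp only: mult_1_right mult_zero_right if_distrib[of "(*) _"])
      also have "\<dots> = v $ i - u $ i"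
        by simp
      finally have "(\<Sum>j\<in>UNIV. (v - u) $ j * indicator (?A j) \<omega>) = v $ i - u $ i" .
      moreover have "v $ i + \<epsilon> \<omega> $ i \<le> (MAX k. v $ k + \<epsilon> \<omega> $ k)"
        by (rule Max_ge) auto
      moreover have "u $ i + \<epsilon> \<omega> $ i = (MAX k. u $ k + \<epsilon> \<omega> $ k)"
        using i by blast
      ultimately show ?case by linarith
    qed
  qed
  also have "\<dots> = surplus M \<epsilon> v - surplus M \<epsilon> u"
    unfolding surplus_def
    by (intro Bochner_Integration.integral_diff integrable_max_utility prob int)
  finally show ?thesis by simp
qed

section \<open>Representation of the surplus by its conjugate\<close>

theorem theorem4:
  fixes M :: "'a measure" and \<epsilon> :: "'a \<Rightarrow> real ^ 'n"
  assumes "prob_space M"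
    and "\<epsilon> \<in> borel_measurable M"
    and "integrable M \<epsilon>"
    and "absolutely_continuous lborel (distr M borel \<epsilon>)"
    and "topological_support (distr M borel \<epsilon>) = UNIV"
    and "strongly_convex_on norm_l1 prob_simplex (convex_conjugate (surplus M \<epsilon>))"
  shows "\<forall>u :: real ^ 'n.
    ereal (surplus M \<epsilon> u)
      = (SUP p\<in>prob_simplex. ereal (p \<bullet> u) - convex_conjugate (surplus M \<epsilon>) p) \<and>
    (\<forall>p. is_arg_max (\<lambda>p. ereal (p \<bullet> u) - convex_conjugate (surplus M \<epsilon>) p)
             (\<lambda>p. p \<in> prob_simplex) p
         \<longleftrightarrow> p = choice_probabilities M \<epsilon> u)"
proof
  fix u :: "real ^ 'n"
  let ?E = "surplus M \<epsilon>"
  let ?J = "\<lambda>p. ereal (p \<bullet> u) - convex_conjugate ?E p"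
  define g where "g = choice_probabilities M \<epsilon> u"
  have g: "g \<in> prob_simplex"
    unfolding g_def by (rule choice_probabilities_in_simplex) fact+
  have conj_g: "convex_conjugate ?E g = ereal (g \<bullet> u - ?E u)"
    unfolding g_def
    by (intro convex_conjugate_at_subgradient choice_probabilities_subgradient) fact+
  then have Jg: "?J g = ereal (?E u)"
    by simp
  have J_le: "?J p \<le> ereal (?E u)" for p
    by (rule conjugate_objective_le)
  have "ereal (?E u) = (SUP p\<in>prob_simplex. ?J p)"
  proof (rule antisym)
    show "ereal (?E u) \<le> (SUP p\<in>prob_simplex. ?J p)"
      using SUP_upper[OF g, of ?J] Jg by simp
  qed (intro SUP_least J_le)
  moreover have "is_arg_max ?J (\<lambda>p. p \<in> prob_simplex) p \<longleftrightarrow> p = g" for p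
  proof
    assume "is_arg_max ?J (\<lambda>p. p \<in> prob_simplex) p"
    then have p: "p \<in> prob_simplex" and "\<not> ?J p < ?J g"
      using g unfolding is_arg_max_def by blast+
    then have "?J p = ereal (?E u)"
      using J_le[of p] Jg by (simp add: not_less)
    then have "convex_conjugate ?E p = ereal (p \<bullet> u - ?E u)"
      by (cases "convex_conjugate ?E p") auto
    then have "norm_l1 (p - g) = 0"
      using maximizers_unique_if_strongly_convex[OF assms(6) p _ g conj_g] by blast
    then show "p = g"
      by (simp add: norm_l1_eq_0_iff)
  next
    assume "p = g"
    then show "is_arg_max ?J (\<lambda>p. p \<in> prob_simplex) p"
      using g J_le Jg unfolding is_arg_max_def by (simp add: not_less)
  qed
  ultimately show "ereal (?E u) = (SUP p\<in>prob_simplex. ?J p) \<and>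
      (\<forall>p. is_arg_max ?J (\<lambda>p. p \<in> prob_simplex) p \<longleftrightarrow> p = choice_probabilities M \<epsilon> u)"
    unfolding g_def by blast
qed

end
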